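(* Let $(\Gamma,K)$ be a canonical bilinear lattice of tubular type associated with a symbol with $\varepsilon=1$, let $n=\mathrm{rk}(\Gamma)$, and let $\widetilde W$ be the hyperbolic extension of the associated reflection group, with set of reflections $\widetilde T$ and hyperbolic Coxeter element $\tilde c$. Then $\ell_{\widetilde T}(\tilde c)=n$.
   Context: Symbol with $\varepsilon=1$: integers $t\ge0$, $p_1,\dots,p_t\ge2$, $d_i,f_i\ge1$ with $f_i\mid d_i$; put $e_i=d_i/f_i$, $n=\sum_{i=1}^t(p_i-1)+2$, $\Omega=\{(i,j)\mid1\le i\le t,1\le j\le p_i-1\}$. Tubular type means $\sum_{i=1}^td_i(1-\frac1{p_i})=2$. The canonical bilinear lattice $(\Gamma,K)$ is the free abelian group with ordered basis $$R=(\alpha_{(t,p_t-1)},\dots,\alpha_{(t,1)},\dots,\alpha_{(1,p_1-1)},\dots,\alpha_{(1,1)},\alpha_0,\alpha_{0^*})$$ with bilinear form $K=\langle-,-\rangle$ given, for some $\kappa\in\mathbb{N}$, $\kappa\geq 1$, with all $\frac{\kappa f_i}{e_i}\in\mathbb{N}$, by $\langle\alpha_{(i,j)},\alpha_{(i,j)}\rangle=\frac{\kappa f_i}{e_i}$; $\langle\alpha_{(i,j)},\alpha_{(i,j-1)}\rangle=-\frac{\kappa f_i}{e_i}$ for $2\le j\le p_i-1$; $\langle\alpha_{(i,1)},\alpha_0\rangle=\langle\alpha_{(i,1)},\alpha_{0^*}\rangle=-\kappa f_i$; $\langle\alpha_0,\alpha_0\rangle=\kappa$, $\langle\alpha_0,\alpha_{0^*}\rangle=2\kappa$,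 $\langle\alpha_{0^*},\alpha_{0^*}\rangle=\kappa$; all other values on basis pairs are $0$. $B=(-,-)$ is the symmetrization $(\alpha,\beta)=\langle\alpha,\beta\rangle+\langle\beta,\alpha\rangle$, extended to $V=\mathbb{R}\otimes\Gamma$. The element $a=\alpha_{0^*}-\alpha_0$ lies in $\mathrm{Rad}(B)$, and $\Gamma=\Gamma_\circ\oplus\mathbb{Z}a$ with $\Gamma_\circ$ spanned by $\alpha_0$ and the $\alpha_{(i,j)}$. Hyperbolic extension: $\widetilde V=V\oplus\mathbb{R}a'$, with symmetric bilinear form $\widetilde B$ such that $\widetilde B|_{V\times V}=B$, $\widetilde B(x,a')=0$ for $x\in\Gamma_\circ$, $\widetilde B(a',a')=0$, $\widetilde B(a,a')=1$. For non-isotropic $v\in\widetilde V$, $\tilde s_v(x)=x-2\frac{\widetilde B(x,v)}{\widetilde B(v,v)}v$. $\widetilde W$ is the group generated by the $\tilde s_\alpha$, $\alpha\in R$; $\widetilde T$ is the set of $\widetilde W$-conjugates of these generators; $\tilde c$ is the product of the $\tilde s_\alpha$, $\alpha\in R$, in the order of $R$. $\ell_{\widetilde T}(w)$ is the minimal $r$ such that $w$ is a product of $r$ elements of $\widetilde T$. *)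

theory Defs
  imports
    Complex_Main
    "HOL-Algebra.Bij"
    "HOL-Algebra.Generated_Groups"
    "HOL-Algebra.Free_Abelian_Groups"
begin

section \<open>Symbols\<close>

text \<open>Symbols with \<open>\<epsilon> = 1\<close>. The sequences \<open>p\<close>, \<open>d\<close>, \<open>f\<close> are indexed by \<open>1, \<dots>, t\<close>;
  their values at other indices are never used.\<close>

record symbol =
  sym_t :: nat
  sym_p :: "nat \<Rightarrow> nat"
  sym_d :: "nat \<Rightarrow> nat"
  sym_f :: "nat \<Rightarrow> nat"

definition is_symbol :: "symbol \<Rightarrow> bool" where
  "is_symbol S \<longleftrightarrow> (\<forall>i\<in>{1..sym_t S}.
     sym_p S i \<ge> 2 \<and> sym_d S i \<ge> 1 \<and> sym_f S i \<ge> 1 \<and> sym_f S i dvd sym_d S i)"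

definition sym_e :: "symbol \<Rightarrow> nat \<Rightarrow> nat" where
  "sym_e S i = sym_d S i div sym_f S i"

definition tubular :: "symbol \<Rightarrow> bool" where
  "tubular S \<longleftrightarrow> (\<Sum>i=1..sym_t S. real (sym_d S i) * (1 - 1 / real (sym_p S i))) = 2"

definition admissible :: "symbol \<Rightarrow> nat \<Rightarrow> bool" where
  "admissible S \<kappa> \<longleftrightarrow>
     \<kappa> \<ge> 1 \<and> (\<forall>i\<in>{1..sym_t S}. real \<kappa> * real (sym_f S i) / real (sym_e S i) \<in> \<nat>)"


section \<open>The canonical bilinear lattice\<close>

text \<open>Vectors are coordinate functions. The coordinate indices \<open>Arm i j\<close>, \<open>Base\<close>, \<open>Base_star\<close>
  belong to \<open>\<alpha>\<^sub>(\<^sub>i\<^sub>,\<^sub>j\<^sub>)\<close>, \<open>\<alpha>\<^sub>0\<close>, \<open>\<alpha>\<^sub>0\<^sub>*\<close>, and \<open>Hyp\<close> belongs to the additional isotropic vector \<open>a'\<close> of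
  the hyperbolic extension.\<close>

datatype index = Arm nat nat | Base | Base_star | Hyp

type_synonym vect = "index \<Rightarrow> real"

definition basis_vec :: "index \<Rightarrow> vect" where
  "basis_vec u = (\<lambda>v. if v = u then 1 else 0)"

definition index_list :: "symbol \<Rightarrow> index list" where
  "index_list S =
     concat (map (\<lambda>i. map (Arm i) (rev [1..<sym_p S i])) (rev [1..<Suc (sym_t S)]))
     @ [Base, Base_star]"

definition ordered_basis :: "symbol \<Rightarrow> vect list" where
  "ordered_basis S = map basis_vec (index_list S)"

text \<open>\<open>V = \<real> \<otimes> \<Gamma>\<close>, and \<open>\<Gamma>\<close> as the group of its integral vectors.\<close>

definition vspace :: "symbol \<Rightarrow> vect set" where
  "vspace S = {x. \<forall>u. u \<notin> set (index_list S) \<longrightarrow> x u = 0}"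

definition cb_lattice :: "symbol \<Rightarrow> vect monoid" where
  "cb_lattice S = \<lparr>carrier = {x \<in> vspace S. \<forall>u. x u \<in> \<int>},
                monoid.mult = (\<lambda>x y u. x u + y u), one = (\<lambda>u. 0)\<rparr>"

definition free_rank :: "('a, 'b) monoid_scheme \<Rightarrow> nat" where
  "free_rank G = (THE n. G \<cong> free_Abelian_group {..<n})"

text \<open>The values of \<open>K\<close> on pairs of basis vectors.\<close>

fun gram :: "symbol \<Rightarrow> nat \<Rightarrow> index \<Rightarrow> index \<Rightarrow> real" where
  "gram S \<kappa> (Arm i j) (Arm k l) =
     (if k = i \<and> l = j then real \<kappa> * real (sym_f S i) / real (sym_e S i)
      else if k = i \<and> j = Suc l then - (real \<kappa> * real (sym_f S i) / real (sym_e S i))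
      else 0)"
| "gram S \<kappa> (Arm i j) Base = (if j = 1 then - (real \<kappa> * real (sym_f S i)) else 0)"
| "gram S \<kappa> (Arm i j) Base_star = (if j = 1 then - (real \<kappa> * real (sym_f S i)) else 0)"
| "gram S \<kappa> Base Base = real \<kappa>"
| "gram S \<kappa> Base Base_star = 2 * real \<kappa>"
| "gram S \<kappa> Base_star Base_star = real \<kappa>"
| "gram S \<kappa> _ _ = 0"

text \<open>The bilinear form \<open>K\<close>, extended to \<open>V\<close>. It only sees the coordinates belonging to \<open>V\<close>.\<close>

definition K_form :: "symbol \<Rightarrow> nat \<Rightarrow> vect \<Rightarrow> vect \<Rightarrow> real" where
  "K_form S \<kappa> x y =
     (\<Sum>u\<in>set (index_list S). \<Sum>v\<in>set (index_list S). x u * y v * gram S \<kappa> u v)"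

definition B_form :: "symbol \<Rightarrow> nat \<Rightarrow> vect \<Rightarrow> vect \<Rightarrow> real" where
  "B_form S \<kappa> x y = K_form S \<kappa> x y + K_form S \<kappa> y x"


section \<open>The hyperbolic extension\<close>

definition hyp_vspace :: "symbol \<Rightarrow> vect set" where
  "hyp_vspace S = {x. \<forall>u. u \<notin> insert Hyp (set (index_list S)) \<longrightarrow> x u = 0}"

text \<open>Since \<open>\<alpha>\<^sub>0\<^sub>* = \<alpha>\<^sub>0 + a\<close>, the component in \<open>\<real>a\<close> of a vector \<open>x\<close> of
  \<open>V = (\<real> \<otimes> \<Gamma>\<^sub>\<circ>) \<oplus> \<real>a\<close> is its \<open>\<alpha>\<^sub>0\<^sub>*\<close>-coordinate; this is the value of the form on \<open>x\<close> and \<open>a'\<close>.\<close>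

definition hyp_form :: "symbol \<Rightarrow> nat \<Rightarrow> vect \<Rightarrow> vect \<Rightarrow> real" where
  "hyp_form S \<kappa> x y = B_form S \<kappa> x y + x Base_star * y Hyp + x Hyp * y Base_star"

definition hyp_refl :: "symbol \<Rightarrow> nat \<Rightarrow> vect \<Rightarrow> vect \<Rightarrow> vect" where
  "hyp_refl S \<kappa> v = (\<lambda>x\<in>hyp_vspace S.
     (\<lambda>u. x u - 2 * (hyp_form S \<kappa> x v / hyp_form S \<kappa> v v) * v u))"

definition hyp_group :: "symbol \<Rightarrow> nat \<Rightarrow> (vect \<Rightarrow> vect) monoid" where
  "hyp_group S \<kappa> = (BijGroup (hyp_vspace S))
     \<lparr>carrier := generate (BijGroup (hyp_vspace S)) (hyp_refl S \<kappa> ` set (ordered_basis S))\<rparr>"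

definition hyp_reflections :: "symbol \<Rightarrow> nat \<Rightarrow> (vect \<Rightarrow> vect) set" where
  "hyp_reflections S \<kappa> =
     {w \<otimes>\<^bsub>hyp_group S \<kappa>\<^esub> hyp_refl S \<kappa> v \<otimes>\<^bsub>hyp_group S \<kappa>\<^esub> inv\<^bsub>hyp_group S \<kappa>\<^esub> w | w v.
        w \<in> carrier (hyp_group S \<kappa>) \<and> v \<in> set (ordered_basis S)}"

definition list_mult :: "('a, 'b) monoid_scheme \<Rightarrow> 'a list \<Rightarrow> 'a" where
  "list_mult G xs = foldr (\<lambda>x y. x \<otimes>\<^bsub>G\<^esub> y) xs \<one>\<^bsub>G\<^esub>"

definition hyp_coxeter :: "symbol \<Rightarrow> nat \<Rightarrow> vect \<Rightarrow> vect" where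
  "hyp_coxeter S \<kappa> = list_mult (hyp_group S \<kappa>) (map (hyp_refl S \<kappa>) (ordered_basis S))"

definition word_length :: "('a, 'b) monoid_scheme \<Rightarrow> 'a set \<Rightarrow> 'a \<Rightarrow> nat" where
  "word_length G T w = (LEAST r. \<exists>xs. length xs = r \<and> set xs \<subseteq> T \<and> list_mult G xs = w)"


section \<open>Consistency of the coordinate description\<close>

lemma set_index_list:
  "set (index_list S) = (\<Union>i\<in>{1..sym_t S}. Arm i ` {1..<sym_p S i}) \<union> {Base, Base_star}"
  unfolding index_list_def by fastforce

lemma Hyp_notin_index_list [simp]: "Hyp \<notin> set (index_list S)"
  by (auto simp: set_index_list)

lemma K_form_basis_vec:
  assumes "u \<in> set (index_list S)" "v \<in> set (index_list S)"
  shows "K_form S \<kappa> (basis_vec u) (basis_vec v) = gram S \<kappa> u v"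
proof -
  have "K_form S \<kappa> (basis_vec u) (basis_vec v) =
      (\<Sum>a\<in>set (index_list S). \<Sum>b\<in>set (index_list S).
        if b = v then if a = u then gram S \<kappa> a b else 0 else 0)"
    unfolding K_form_def basis_vec_def by (intro sum.cong refl) simp
  then show ?thesis
    using assms by simp
qed

lemma vspace_subset_hyp_vspace: "vspace S \<subseteq> hyp_vspace S"
  by (auto simp: vspace_def hyp_vspace_def)

lemma hyp_form_on_vspace:
  assumes "x \<in> vspace S" "y \<in> vspace S"
  shows "hyp_form S \<kappa> x y = B_form S \<kappa> x y"
  using assms by (simp add: hyp_form_def vspace_def)

lemma B_form_basis_vec_Hyp: "B_form S \<kappa> x (basis_vec Hyp) = 0"
proof -
  have [simp]: "basis_vec Hyp u = 0" if "u \<in> set (index_list S)" for u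
    using that by (auto simp: basis_vec_def)
  show ?thesis
    by (simp add: B_form_def K_form_def)
qed

lemma hyp_form_Hyp:
  "x Base_star = 0 \<Longrightarrow> x \<in> vspace S \<Longrightarrow> hyp_form S \<kappa> x (basis_vec Hyp) = 0"
  "hyp_form S \<kappa> (basis_vec Hyp) (basis_vec Hyp) = 0"
  "hyp_form S \<kappa> (\<lambda>u. basis_vec Base_star u - basis_vec Base u) (basis_vec Hyp) = 1"
  by (simp_all add: hyp_form_def B_form_basis_vec_Hyp) (simp_all add: basis_vec_def vspace_def)

lemma hyp_form_basis_nonisotropic:
  assumes "is_symbol S" "\<kappa> \<ge> 1" "v \<in> set (ordered_basis S)"
  shows "hyp_form S \<kappa> v v > 0"
proof -
  obtain u where u: "u \<in> set (index_list S)" "v = basis_vec u"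
    using assms(3) by (auto simp: ordered_basis_def)
  have "hyp_form S \<kappa> v v = 2 * gram S \<kappa> u u"
    using u by (auto simp: hyp_form_def B_form_def K_form_basis_vec) (auto simp: basis_vec_def)
  moreover have "gram S \<kappa> u u > 0"
  proof (cases u)
    case (Arm i j)
    then have "i \<in> {1..sym_t S}"
      using u(1) by (auto simp: set_index_list)
    then have "sym_f S i \<ge> 1" "sym_f S i dvd sym_d S i" "sym_d S i \<ge> 1"
      using assms(1) by (auto simp: is_symbol_def)
    then have "sym_f S i > 0" "sym_e S i > 0"
      by (auto simp: sym_e_def div_greater_zero_iff dvd_imp_le)
    then show ?thesis
      using assms(2) Arm by simp
  qed (use assms(2) u(1) in auto)
  ultimately show ?thesis
    by simp
qed

lemma hyp_refl_in_Bij: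
  assumes "v \<in> hyp_vspace S" "hyp_form S \<kappa> v v \<noteq> 0"
  shows "hyp_refl S \<kappa> v \<in> carrier (BijGroup (hyp_vspace S))"
proof -
  let ?s = "hyp_refl S \<kappa> v"
  have lin: "hyp_form S \<kappa> (\<lambda>u. x u - c * y u) v = hyp_form S \<kappa> x v - c * hyp_form S \<kappa> y v"
    for x y c
    by (simp add: hyp_form_def B_form_def K_form_def algebra_simps sum_subtractf sum_distrib_left)
  have mem: "?s x \<in> hyp_vspace S" if "x \<in> hyp_vspace S" for x
    using that assms(1) by (auto simp: hyp_refl_def hyp_vspace_def)
  have inv: "?s (?s x) = x" if x: "x \<in> hyp_vspace S" for x
  proof -
    let ?c = "2 * (hyp_form S \<kappa> x v / hyp_form S \<kappa> v v)"
    have sx: "?s x = (\<lambda>u. x u - ?c * v u)"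
      using x by (simp add: hyp_refl_def)
    have "hyp_form S \<kappa> (?s x) v = - hyp_form S \<kappa> x v"
      unfolding sx lin using assms(2) by simp
    then have "?s (?s x) = (\<lambda>u. ?s x u + ?c * v u)"
      using mem [OF x] by (simp add: hyp_refl_def)
    then show ?thesis
      by (simp add: sx)
  qed
  have "bij_betw ?s (hyp_vspace S) (hyp_vspace S)"
    by (rule bij_betw_byWitness [where f' = ?s]) (use mem inv in auto)
  then show ?thesis
    by (simp add: BijGroup_def Bij_def hyp_refl_def)
qed

lemma free_rank_cb_lattice: "free_rank (cb_lattice S) = (\<Sum>i=1..sym_t S. sym_p S i - 1) + 2"
proof -
  let ?I = "set (index_list S)" and ?F = "\<lambda>(c :: index \<Rightarrow>\<^sub>0 int) (u :: index). real_of_int (Poly_Mapping.lookup c u)"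
  have card: "card ?I = (\<Sum>i=1..sym_t S. sym_p S i - 1) + 2"
  proof -
    have "card (\<Union>i\<in>{1..sym_t S}. Arm i ` {1..<sym_p S i}) = (\<Sum>i=1..sym_t S. sym_p S i - 1)"
      by (subst card_UN_disjoint) (auto simp: card_image inj_on_def)
    then show ?thesis
      unfolding set_index_list by (subst card_Un_disjoint) auto
  qed
  have "?F \<in> iso (free_Abelian_group ?I) (cb_lattice S)"
  proof (rule isoI)
    show "?F \<in> hom (free_Abelian_group ?I) (cb_lattice S)"
    proof (rule homI)
      fix c d :: "index \<Rightarrow>\<^sub>0 int"
      assume "c \<in> carrier (free_Abelian_group ?I)"
      then have "Poly_Mapping.keys c \<subseteq> ?I"
        by simp
      then have "Poly_Mapping.lookup c u = 0" if "u \<notin> ?I" for u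
        using that by (meson in_keys_iff subsetD)
      then show "?F c \<in> carrier (cb_lattice S)"
        by (simp add: cb_lattice_def vspace_def)
      show "?F (c \<otimes>\<^bsub>free_Abelian_group ?I\<^esub> d) = ?F c \<otimes>\<^bsub>cb_lattice S\<^esub> ?F d"
        by (rule ext) (simp add: cb_lattice_def lookup_add)
    qed
    show "bij_betw ?F (carrier (free_Abelian_group ?I)) (carrier (cb_lattice S))"
      unfolding bij_betw_def
    proof (intro conjI equalityI subsetI)
      show "inj_on ?F (carrier (free_Abelian_group ?I))"
        by (auto simp: inj_on_def fun_eq_iff intro: poly_mapping_eqI)
    next
      fix x assume "x \<in> ?F ` carrier (free_Abelian_group ?I)"
      then show "x \<in> carrier (cb_lattice S)"
        using \<open>?F \<in> hom _ _\<close> by (auto simp del: carrier_free_Abelian_group_iff simp: hom_def)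
    next
      fix x assume x: "x \<in> carrier (cb_lattice S)"
      let ?c = "Abs_poly_mapping (\<lambda>u. \<lfloor>x u\<rfloor>)"
      have "finite {u. \<lfloor>x u\<rfloor> \<noteq> 0}"
        by (rule finite_subset [of _ ?I]) (use x in \<open>auto simp: cb_lattice_def vspace_def\<close>)
      then have l: "Poly_Mapping.lookup ?c = (\<lambda>u. \<lfloor>x u\<rfloor>)"
        by simp
      have "x = ?F ?c"
        unfolding l using x by (auto simp: cb_lattice_def fun_eq_iff)
      moreover have "?c \<in> carrier (free_Abelian_group ?I)"
        using x by (force simp: l in_keys_iff cb_lattice_def vspace_def)
      ultimately show "x \<in> ?F ` carrier (free_Abelian_group ?I)"
        by blast
    qed
  qed
  then have iso: "free_Abelian_group ?I \<cong> cb_lattice S"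
    by (auto simp: is_iso_def)
  then have iso': "cb_lattice S \<cong> free_Abelian_group ?I"
    using group.iso_sym group_free_Abelian_group by blast
  have "cb_lattice S \<cong> free_Abelian_group {..<n} \<longleftrightarrow> n = card ?I" for n :: nat
  proof -
    have "cb_lattice S \<cong> free_Abelian_group {..<n} \<longleftrightarrow>
        free_Abelian_group ?I \<cong> free_Abelian_group {..<n}"
      using iso_trans [OF iso] iso_trans [OF iso'] by blast
    also have "\<dots> \<longleftrightarrow> ?I \<approx> {..<n}"
      by (rule isomorphic_free_Abelian_groups)
    also have "\<dots> \<longleftrightarrow> n = card ?I"
      by (auto simp: eqpoll_iff_card)
    finally show ?thesis .
  qed
  then show ?thesis
    by (simp add: free_rank_def card)
qed

end

theory Submission
  imports Defs "Jordan_Normal_Form.Determinant"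
begin

text \<open>
  Let \<open>c\<close> be the hyperbolic Coxeter element. It is by definition a product of \<open>n\<close> reflections, so the point
  is that fewer do not suffice. Two invariants of a product of \<open>r\<close> reflections give this: its
  determinant is \<open>(-1)\<^sup>r\<close>, and it fixes the common kernel of \<open>r\<close> linear functionals pointwise.

  The vectors fixed by \<open>c\<close> are few. Since the simple roots are linearly independent, a
  vector fixed by the product of all simple reflections is fixed by each of them
  (\<open>fixed_by_simple_product_orthogonal\<close>), hence is orthogonal to all simple roots. Such a vector is
  determined by its coordinates at \<open>\<alpha>\<^sub>0\<close> and \<open>\<alpha>\<^sub>0\<^sub>*\<close>: if both vanish, then pairing with the radical
  vector \<open>a\<close> kills its \<open>a'\<close>-coordinate, and the rest is a vector on the arms orthogonal to all arm
  roots, which is zero because each arm is a positive definite form of type \<open>A\<close>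
  (\<open>orthogonal_determined_by_base_coordinates\<close>). So the fixed space has dimension at most \<open>2\<close>.

  The whole space has dimension \<open>n + 1\<close>. The fixed space of a product of \<open>r\<close> reflections has
  dimension at least \<open>n + 1 - r\<close>, so that \<open>r \<ge> n - 1\<close> if the product is \<open>c\<close>. The bound misses the goal by one,
  and the determinant closes the gap: \<open>r\<close> and \<open>n\<close> have the same parity, whence \<open>r \<ge> n\<close>
  (\<open>coxeter_needs_rank_many_reflections\<close>).
\<close>

section \<open>Linear maps on coordinate functions\<close>

definition coord_space :: "index list \<Rightarrow> vect set" where
  "coord_space us = {x. \<forall>u. u \<notin> set us \<longrightarrow> x u = 0}"

text \<open>The dimension of the space depends on the symbol, so that linearity is relative to a set of
  coordinate functions rather than to a type. One identity with a single scalar covers sums and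
  multiples, as long as the set contains the zero vector.\<close>

definition linear_functional_on :: "vect set \<Rightarrow> (vect \<Rightarrow> real) \<Rightarrow> bool" where
  "linear_functional_on U \<phi> \<longleftrightarrow>
     (\<forall>x\<in>U. \<forall>y\<in>U. \<forall>c. \<phi> (\<lambda>u. x u + c * y u) = \<phi> x + c * \<phi> y)"

definition linear_map_on :: "vect set \<Rightarrow> (vect \<Rightarrow> vect) \<Rightarrow> bool" where
  "linear_map_on U g \<longleftrightarrow> g \<in> U \<rightarrow> U \<and> (\<forall>u. linear_functional_on U (\<lambda>x. g x u))"

lemma basis_vec_in_coord_space: "u \<in> set us \<Longrightarrow> basis_vec u \<in> coord_space us"
  by (auto simp: coord_space_def basis_vec_def)

lemma basis_vec_apply: "basis_vec u v = (if v = u then 1 else 0)"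
  by (simp add: basis_vec_def)

lemma coord_space_add_scaled:
  "x \<in> coord_space us \<Longrightarrow> y \<in> coord_space us \<Longrightarrow> (\<lambda>u. x u + c * y u) \<in> coord_space us"
  by (auto simp: coord_space_def)

lemma linear_map_on_add_scaled:
  assumes "linear_map_on U g" "x \<in> U" "y \<in> U"
  shows "g (\<lambda>u. x u + c * y u) = (\<lambda>u. g x u + c * g y u)"
  using assms by (auto simp: linear_map_on_def linear_functional_on_def)

lemma linear_functional_on_coordinate: "linear_functional_on U (\<lambda>x. x u)"
  by (simp add: linear_functional_on_def)

lemma linear_functional_on_comp:
  assumes "linear_functional_on U \<phi>" "linear_map_on U g"
  shows "linear_functional_on U (\<lambda>x. \<phi> (g x))"
  unfolding linear_functional_on_def
proof (intro ballI allI)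
  fix x y c assume "x \<in> U" "y \<in> U"
  moreover from this have "g x \<in> U" "g y \<in> U"
    using assms(2) by (auto simp: linear_map_on_def)
  ultimately show "\<phi> (g (\<lambda>u. x u + c * y u)) = \<phi> (g x) + c * \<phi> (g y)"
    using assms by (simp add: linear_map_on_add_scaled linear_functional_on_def)
qed

lemma linear_functional_on_expand:
  assumes \<phi>: "linear_functional_on (coord_space us) \<phi>" and x: "x \<in> coord_space us"
  shows "\<phi> x = (\<Sum>u\<in>set us. x u * \<phi> (basis_vec u))"
proof -
  have add: "\<phi> (\<lambda>u. y u + c * z u) = \<phi> y + c * \<phi> z"
    if "y \<in> coord_space us" "z \<in> coord_space us" for y z c
    using \<phi> that by (simp add: linear_functional_on_def)
  have "\<phi> (\<lambda>v. if v \<in> A then x v else 0) = (\<Sum>u\<in>A. x u * \<phi> (basis_vec u))"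
    if "finite A" "A \<subseteq> set us" for A
    using that
  proof (induction A)
    case empty
    show ?case
      using add [of "\<lambda>_. 0" "\<lambda>_. 0" 1] by (simp add: coord_space_def)
  next
    case (insert u A)
    let ?y = "\<lambda>v. if v \<in> A then x v else 0"
    have "(\<lambda>v. if v \<in> insert u A then x v else 0) = (\<lambda>v. ?y v + x u * basis_vec u v)"
      using insert.hyps by (auto simp: basis_vec_def)
    moreover have "\<phi> (\<lambda>v. ?y v + x u * basis_vec u v) = \<phi> ?y + x u * \<phi> (basis_vec u)"
      using insert.prems by (intro add basis_vec_in_coord_space) (auto simp: coord_space_def)
    ultimately have "\<phi> (\<lambda>v. if v \<in> insert u A then x v else 0) = \<phi> ?y + x u * \<phi> (basis_vec u)"
      by simp
    then show ?case
      using insert by simp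
  qed
  from this [of "set us"]
  have "\<phi> (\<lambda>v. if v \<in> set us then x v else 0) = (\<Sum>u\<in>set us. x u * \<phi> (basis_vec u))"
    by simp
  moreover have "(\<lambda>v. if v \<in> set us then x v else 0) = x"
    using x by (auto simp: coord_space_def)
  ultimately show ?thesis
    by simp
qed

lemma linear_functional_on_expand_nth:
  assumes "distinct us" "linear_functional_on (coord_space us) \<phi>" "x \<in> coord_space us"
  shows "\<phi> x = (\<Sum>j<length us. \<phi> (basis_vec (us ! j)) * x (us ! j))"
  unfolding linear_functional_on_expand [OF assms(2,3)]
  using sum.reindex_bij_betw [OF bij_betw_nth [OF assms(1) refl refl],
      of "\<lambda>u. x u * \<phi> (basis_vec u)"]
  by (simp add: mult.commute)

text \<open>Padding the coefficient rows of the functionals by zero rows gives a square matrix with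
  determinant zero; the vector sought is in its kernel.\<close>

lemma common_zero_of_few_functionals:
  assumes us: "distinct us"
    and lin: "\<forall>\<phi>\<in>set \<phi>s. linear_functional_on (coord_space us) \<phi>"
    and few: "length \<phi>s < length us"
  shows "\<exists>x\<in>coord_space us. x \<noteq> (\<lambda>_. 0) \<and> (\<forall>\<phi>\<in>set \<phi>s. \<phi> x = 0)"
proof -
  define N where "N = length us"
  define row where "row i = vec N (\<lambda>j. (\<phi>s ! i) (basis_vec (us ! j)))" for i
  define A where "A = mat\<^sub>r N N (\<lambda>i. if i < length \<phi>s then row i else 0\<^sub>v N)"
  have A: "A \<in> carrier_mat N N"
    by (simp add: A_def mat_of_rows_def)
  \<comment> \<open>singles out one of the zero rows, the one just below the coefficient rows\<close>
  have "A = mat\<^sub>r N N (\<lambda>i. if i = length \<phi>s then 0\<^sub>v N else if i < length \<phi>s then row i else 0\<^sub>v N)"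
    unfolding A_def by (rule arg_cong [where f = "mat\<^sub>r N N"]) auto
  also have "det \<dots> = 0"
    by (rule det_row_0) (use few in \<open>auto simp: row_def N_def\<close>)
  finally have "det A = 0" .
  then obtain v where v: "v \<in> carrier_vec N" "v \<noteq> 0\<^sub>v N" "A *\<^sub>v v = 0\<^sub>v N"
    using det_0_iff_vec_prod_zero_field [OF A] by blast
  define x :: vect where
    "x u = (if u \<in> set us then v $ (THE j. j < N \<and> us ! j = u) else 0)" for u
  have x_nth: "x (us ! j) = v $ j" if "j < N" for j
  proof -
    have "(THE j'. j' < N \<and> us ! j' = us ! j) = j"
      using that us by (auto simp: N_def nth_eq_iff_index_eq)
    then show ?thesis
      using that by (simp add: x_def N_def)
  qed
  have x: "x \<in> coord_space us"
    by (simp add: x_def coord_space_def)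
  have "x \<noteq> (\<lambda>_. 0)"
  proof
    assume "x = (\<lambda>_. 0)"
    then have "v = 0\<^sub>v N"
      using v(1) x_nth by (intro eq_vecI) auto
    with v(2) show False ..
  qed
  moreover have "\<phi> x = 0" if mem: "\<phi> \<in> set \<phi>s" for \<phi>
  proof -
    obtain i where i: "i < length \<phi>s" "\<phi> = \<phi>s ! i"
      using mem by (auto simp: in_set_conv_nth)
    have "\<phi> x = (\<Sum>j<N. \<phi> (basis_vec (us ! j)) * x (us ! j))"
      unfolding N_def using us lin mem x by (intro linear_functional_on_expand_nth) auto
    also have "\<dots> = (A *\<^sub>v v) $ i"
      using i few v(1) x_nth
      by (simp add: A_def row_def N_def scalar_prod_def atLeast0LessThan)
    also have "\<dots> = 0"
      using v(3) i few by (simp add: N_def)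
    finally show ?thesis .
  qed
  ultimately show ?thesis
    using x by blast
qed

definition coord_mat :: "index list \<Rightarrow> (vect \<Rightarrow> vect) \<Rightarrow> real mat" where
  "coord_mat us g = mat (length us) (length us) (\<lambda>(i, j). g (basis_vec (us ! j)) (us ! i))"

definition coord_det :: "index list \<Rightarrow> (vect \<Rightarrow> vect) \<Rightarrow> real" where
  "coord_det us g = det (coord_mat us g)"

lemma coord_det_comp:
  assumes us: "distinct us"
    and f: "linear_map_on (coord_space us) f" and g: "linear_map_on (coord_space us) g"
  shows "coord_det us (compose (coord_space us) f g) = coord_det us f * coord_det us g"
proof -
  have "coord_mat us (compose (coord_space us) f g) = coord_mat us f * coord_mat us g"
  proof (rule eq_matI)
    fix i j assume "i < dim_row (coord_mat us f * coord_mat us g)"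
      "j < dim_col (coord_mat us f * coord_mat us g)"
    then have ij: "i < length us" "j < length us"
      by (simp_all add: coord_mat_def)
    let ?e = "basis_vec (us ! j)"
    have e: "?e \<in> coord_space us"
      using ij by (simp add: basis_vec_in_coord_space)
    then have "g ?e \<in> coord_space us"
      using g by (auto simp: linear_map_on_def)
    then have "f (g ?e) (us ! i)
        = (\<Sum>k<length us. f (basis_vec (us ! k)) (us ! i) * g ?e (us ! k))"
      using us f by (intro linear_functional_on_expand_nth) (auto simp: linear_map_on_def)
    then show "coord_mat us (compose (coord_space us) f g) $$ (i, j)
        = (coord_mat us f * coord_mat us g) $$ (i, j)"
      using ij e by (simp add: coord_mat_def compose_def scalar_prod_def atLeast0LessThan)
  qed (simp_all add: coord_mat_def)
  moreover have "coord_mat us h \<in> carrier_mat (length us) (length us)" for h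
    by (simp add: coord_mat_def)
  ultimately show ?thesis
    by (simp add: coord_det_def det_mult [of _ "length us"])
qed

lemma coord_det_id:
  assumes "distinct us"
  shows "coord_det us (\<lambda>x\<in>coord_space us. x) = 1"
proof -
  have "coord_mat us (\<lambda>x\<in>coord_space us. x) = 1\<^sub>m (length us)"
    using assms
    by (intro eq_matI)
       (auto simp: coord_mat_def basis_vec_in_coord_space basis_vec_apply nth_eq_iff_index_eq)
  then show ?thesis
    by (simp add: coord_det_def)
qed

text \<open>Along a basis vector, a reflection negates that column of the identity matrix and changes
  otherwise only the corresponding row, so expansion along the column leaves the determinant of an
  identity matrix.\<close>

lemma coord_det_basis_reflection:
  assumes us: "distinct us" and v: "v \<in> set us" and \<phi>: "\<phi> (basis_vec v) = 2"
    and s: "\<And>x. x \<in> coord_space us \<Longrightarrow> s x = (\<lambda>u. x u - \<phi> x * basis_vec v u)"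
  shows "coord_det us s = - 1"
proof -
  define N where "N = length us"
  let ?A = "coord_mat us s"
  obtain k where k: "k < N" "us ! k = v"
    using v by (auto simp: in_set_conv_nth N_def)
  have A: "?A \<in> carrier_mat N N"
    by (simp add: coord_mat_def N_def)
  have entry: "?A $$ (i, j) = (if i = j then 1 else 0) - (if i = k then \<phi> (basis_vec (us ! j)) else 0)"
    if "i < N" "j < N" for i j
    using that us k s [of "basis_vec (us ! j)"]
    by (auto simp: coord_mat_def N_def basis_vec_in_coord_space basis_vec_apply nth_eq_iff_index_eq)
  have "det ?A = (\<Sum>i<N. ?A $$ (i, k) * cofactor ?A i k)"
    by (rule laplace_expansion_column [OF A k(1)])
  also have "\<dots> = (\<Sum>i<N. if i = k then - cofactor ?A k k else 0)"
    using k \<phi> by (intro sum.cong) (auto simp: entry)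
  also have "\<dots> = - det (mat_delete ?A k k)"
    using k(1) by (simp add: cofactor_def)
  also have "mat_delete ?A k k = 1\<^sub>m (N - 1)"
  proof (rule eq_matI)
    fix i j assume "i < dim_row (1\<^sub>m (N - 1) :: real mat)" "j < dim_col (1\<^sub>m (N - 1) :: real mat)"
    then have "i < N - 1" "j < N - 1"
      by simp_all
    then show "mat_delete ?A k k $$ (i, j) = 1\<^sub>m (N - 1) $$ (i, j)"
      using A by (auto simp: mat_delete_def entry)
  qed (use A in \<open>auto simp: mat_delete_def\<close>)
  finally show ?thesis
    by (simp add: coord_det_def)
qed

section \<open>The hyperbolic reflection group\<close>

abbreviation hyp_indices :: "symbol \<Rightarrow> index list" where
  "hyp_indices S \<equiv> Hyp # index_list S"

lemma hyp_vspace_eq_coord_space: "hyp_vspace S = coord_space (hyp_indices S)"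
  by (simp add: hyp_vspace_def coord_space_def)

text \<open>The length of the list of simple roots is the rank of the lattice.\<close>

lemma index_list_distinct_length:
  "distinct (index_list S) \<and> length (index_list S) = (\<Sum>i=1..sym_t S. sym_p S i - 1) + 2"
proof -
  define arms where "arms t = concat (map (\<lambda>i. map (Arm i) (rev [1..<sym_p S i])) (rev [1..<Suc t]))" for t
  have "distinct (arms t) \<and> length (arms t) = (\<Sum>i=1..t. sym_p S i - 1)
      \<and> set (arms t) = (\<Union>i\<in>{1..t}. Arm i ` {1..<sym_p S i})" for t
  proof (induction t)
    case 0
    show ?case by (simp add: arms_def)
  next
    case (Suc t)
    have "arms (Suc t) = map (Arm (Suc t)) (rev [1..<sym_p S (Suc t)]) @ arms t"
      by (simp add: arms_def)
    with Suc show ?case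
      by (auto simp: distinct_map inj_on_def atLeastAtMostSuc_conv)
  qed
  moreover have "index_list S = arms (sym_t S) @ [Base, Base_star]"
    by (simp only: index_list_def arms_def)
  ultimately show ?thesis
    by auto
qed

lemma distinct_hyp_indices: "distinct (hyp_indices S)"
  using index_list_distinct_length by simp

lemma linear_functional_on_hyp_form: "linear_functional_on U (\<lambda>x. hyp_form S \<kappa> x v)"
  by (simp add: linear_functional_on_def hyp_form_def B_form_def K_form_def algebra_simps
      sum.distrib sum_distrib_left)

lemma linear_map_on_hyp_refl:
  assumes "v \<in> hyp_vspace S"
  shows "linear_map_on (hyp_vspace S) (hyp_refl S \<kappa> v)"
proof -
  let ?U = "hyp_vspace S"
  have "hyp_refl S \<kappa> v \<in> ?U \<rightarrow> ?U"
    using assms by (auto simp: hyp_refl_def hyp_vspace_def)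
  moreover have "linear_functional_on ?U (\<lambda>x. hyp_refl S \<kappa> v x u)" for u
    unfolding linear_functional_on_def
  proof (intro ballI allI)
    fix x y c assume xy: "x \<in> ?U" "y \<in> ?U"
    then have "(\<lambda>u. x u + c * y u) \<in> ?U"
      by (simp add: hyp_vspace_eq_coord_space coord_space_add_scaled)
    moreover have "hyp_form S \<kappa> (\<lambda>u. x u + c * y u) v = hyp_form S \<kappa> x v + c * hyp_form S \<kappa> y v"
      using linear_functional_on_hyp_form [of UNIV] by (simp add: linear_functional_on_def)
    ultimately show "hyp_refl S \<kappa> v (\<lambda>u. x u + c * y u) u
        = hyp_refl S \<kappa> v x u + c * hyp_refl S \<kappa> v y u"
      using xy by (simp add: hyp_refl_def algebra_simps add_divide_distrib)
  qed
  ultimately show ?thesis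
    by (simp add: linear_map_on_def)
qed

context
  fixes S :: symbol and \<kappa> :: nat
  assumes symbol: "is_symbol S" and \<kappa>: "\<kappa> \<ge> 1"
begin

private abbreviation (input) G where "G \<equiv> hyp_group S \<kappa>"
private abbreviation (input) U where "U \<equiv> hyp_vspace S"

lemma ordered_basis_in_hyp_vspace: "v \<in> set (ordered_basis S) \<Longrightarrow> v \<in> U"
  by (auto simp: ordered_basis_def hyp_vspace_eq_coord_space intro!: basis_vec_in_coord_space)

lemma simple_reflections_in_BijGroup:
  "hyp_refl S \<kappa> ` set (ordered_basis S) \<subseteq> carrier (BijGroup U)"
proof (rule image_subsetI)
  fix v assume v: "v \<in> set (ordered_basis S)"
  from hyp_form_basis_nonisotropic [OF symbol \<kappa> v]
  show "hyp_refl S \<kappa> v \<in> carrier (BijGroup U)"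
    by (intro hyp_refl_in_Bij ordered_basis_in_hyp_vspace v) simp
qed

lemma subgroup_hyp_group: "subgroup (carrier G) (BijGroup U)"
  using group.generate_is_subgroup [OF group_BijGroup simple_reflections_in_BijGroup]
  by (simp add: hyp_group_def)

lemma group_hyp_group: "group G"
  using subgroup.subgroup_is_group [OF subgroup_hyp_group group_BijGroup]
  by (simp add: hyp_group_def)

lemma simple_reflection_in_hyp_group:
  "v \<in> set (ordered_basis S) \<Longrightarrow> hyp_refl S \<kappa> v \<in> carrier G"
  by (simp add: hyp_group_def generate.incl)

lemma hyp_group_mult:
  assumes "g \<in> carrier G" "h \<in> carrier G"
  shows "g \<otimes>\<^bsub>G\<^esub> h = compose U g h"
proof -
  have "g \<in> Bij U" "h \<in> Bij U"
    using assms subgroup.subset [OF subgroup_hyp_group] by (auto simp: BijGroup_def)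
  then show ?thesis
    by (simp add: hyp_group_def BijGroup_def)
qed

lemma hyp_group_one: "\<one>\<^bsub>G\<^esub> = (\<lambda>x\<in>U. x)"
  by (simp add: hyp_group_def BijGroup_def)

lemma linear_map_on_BijGroup_inv:
  assumes g: "g \<in> carrier (BijGroup U)" and lin: "linear_map_on U g"
  shows "linear_map_on U (inv\<^bsub>BijGroup U\<^esub> g)"
proof -
  let ?h = "inv\<^bsub>BijGroup U\<^esub> g"
  interpret B: group "BijGroup U" by (rule group_BijGroup)
  have h: "?h \<in> carrier (BijGroup U)"
    using g by simp
  have mem: "f x \<in> U" if "f \<in> carrier (BijGroup U)" "x \<in> U" for f x
    using that by (auto simp: BijGroup_def dest: Bij_imp_funcset)
  have "compose U g ?h = (\<lambda>x\<in>U. x)" "compose U ?h g = (\<lambda>x\<in>U. x)"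
    using B.r_inv [OF g] B.l_inv [OF g] g h by (auto simp: BijGroup_def)
  then have gh: "g (?h x) = x" and hg: "?h (g x) = x" if "x \<in> U" for x
    using that by (metis compose_eq restrict_apply')+
  have "?h (\<lambda>u. x u + c * y u) = (\<lambda>u. ?h x u + c * ?h y u)" if xy: "x \<in> U" "y \<in> U" for x y c
  proof -
    have hxy: "?h x \<in> U" "?h y \<in> U"
      using mem h xy by auto
    have "g (\<lambda>u. ?h x u + c * ?h y u) = (\<lambda>u. x u + c * y u)"
      using linear_map_on_add_scaled [OF lin hxy] by (simp add: gh xy)
    moreover have "(\<lambda>u. ?h x u + c * ?h y u) \<in> U"
      using hxy by (simp add: hyp_vspace_eq_coord_space coord_space_add_scaled)
    ultimately show ?thesis
      using hg by metis
  qed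
  then show ?thesis
    using mem h by (auto simp: linear_map_on_def linear_functional_on_def)
qed

lemma linear_map_on_hyp_group:
  assumes "g \<in> carrier G"
  shows "linear_map_on U g"
proof -
  let ?R = "hyp_refl S \<kappa> ` set (ordered_basis S)"
  have "g \<in> generate (BijGroup U) ?R"
    using assms by (simp add: hyp_group_def)
  then show ?thesis
  proof (induction rule: generate.induct)
    case one
    show ?case
      by (auto simp: BijGroup_def linear_map_on_def linear_functional_on_def
          hyp_vspace_eq_coord_space coord_space_add_scaled)
  next
    case (incl h)
    then show ?case
      using ordered_basis_in_hyp_vspace linear_map_on_hyp_refl by blast
  next
    case (inv h)
    then show ?case
      using ordered_basis_in_hyp_vspace linear_map_on_hyp_refl simple_reflections_in_BijGroup
      by (intro linear_map_on_BijGroup_inv) blast+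
  next
    case (eng g h)
    then have "g \<in> carrier G" "h \<in> carrier G"
      by (simp_all add: hyp_group_def)
    then have eq: "g \<otimes>\<^bsub>BijGroup U\<^esub> h = compose U g h"
      using hyp_group_mult by (simp add: hyp_group_def)
    have "linear_functional_on U (\<lambda>x. compose U g h x u)" for u
    proof -
      have "linear_functional_on U (\<lambda>x. g (h x) u)"
        using eng.IH linear_functional_on_comp [of U "\<lambda>x. g x u" h] by (simp add: linear_map_on_def)
      then show ?thesis
        by (simp add: linear_functional_on_def compose_def hyp_vspace_eq_coord_space
            coord_space_add_scaled)
    qed
    moreover have "compose U g h \<in> U \<rightarrow> U"
      using eng.IH by (auto simp: linear_map_on_def compose_def)
    ultimately show ?case
      by (simp add: eq linear_map_on_def)
  qed
qed

lemma hyp_group_mem: "g \<in> carrier G \<Longrightarrow> x \<in> U \<Longrightarrow> g x \<in> U"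
  using linear_map_on_hyp_group by (auto simp: linear_map_on_def)

lemma hyp_group_mult_apply:
  "g \<in> carrier G \<Longrightarrow> h \<in> carrier G \<Longrightarrow> x \<in> U \<Longrightarrow> (g \<otimes>\<^bsub>G\<^esub> h) x = g (h x)"
  by (simp add: hyp_group_mult compose_eq)

lemma coord_det_hyp_group_mult:
  assumes "g \<in> carrier G" "h \<in> carrier G"
  shows "coord_det (hyp_indices S) (g \<otimes>\<^bsub>G\<^esub> h)
    = coord_det (hyp_indices S) g * coord_det (hyp_indices S) h"
  using assms linear_map_on_hyp_group
  by (simp add: hyp_group_mult hyp_vspace_eq_coord_space coord_det_comp [OF distinct_hyp_indices])

lemma coord_det_hyp_group_one: "coord_det (hyp_indices S) \<one>\<^bsub>G\<^esub> = 1"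
  by (simp only: hyp_group_one hyp_vspace_eq_coord_space coord_det_id [OF distinct_hyp_indices])

lemma coord_det_simple_reflection:
  assumes "v \<in> set (ordered_basis S)"
  shows "coord_det (hyp_indices S) (hyp_refl S \<kappa> v) = - 1"
proof -
  obtain u where u: "u \<in> set (index_list S)" "v = basis_vec u"
    using assms by (auto simp: ordered_basis_def)
  show ?thesis
  proof (rule coord_det_basis_reflection [OF distinct_hyp_indices, where v = u])
    show "u \<in> set (hyp_indices S)"
      using u by simp
    show "2 * (hyp_form S \<kappa> (basis_vec u) v / hyp_form S \<kappa> v v) = 2"
      using hyp_form_basis_nonisotropic [OF symbol \<kappa> assms] u by simp
    show "hyp_refl S \<kappa> v x
        = (\<lambda>w. x w - 2 * (hyp_form S \<kappa> x v / hyp_form S \<kappa> v v) * basis_vec u w)"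
      if "x \<in> coord_space (hyp_indices S)" for x
      using that u by (simp add: hyp_refl_def hyp_vspace_eq_coord_space)
  qed
qed

lemma simple_reflection_fixes_orthogonal:
  "x \<in> U \<Longrightarrow> hyp_form S \<kappa> x v = 0 \<Longrightarrow> hyp_refl S \<kappa> v x = x"
  by (simp add: hyp_refl_def)

section \<open>Determinant and fixed vectors of a product of reflections\<close>

lemma reflection_in_hyp_group:
  assumes "g \<in> hyp_reflections S \<kappa>"
  shows "g \<in> carrier G"
proof -
  interpret group G by (rule group_hyp_group)
  show ?thesis
    using assms simple_reflection_in_hyp_group by (auto simp: hyp_reflections_def)
qed

lemma simple_reflection_is_reflection:
  assumes "v \<in> set (ordered_basis S)"
  shows "hyp_refl S \<kappa> v \<in> hyp_reflections S \<kappa>"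
proof -
  interpret group G by (rule group_hyp_group)
  have "hyp_refl S \<kappa> v = \<one>\<^bsub>G\<^esub> \<otimes>\<^bsub>G\<^esub> hyp_refl S \<kappa> v \<otimes>\<^bsub>G\<^esub> inv\<^bsub>G\<^esub> \<one>\<^bsub>G\<^esub>"
    using simple_reflection_in_hyp_group [OF assms] by simp
  then show ?thesis
    using assms unfolding hyp_reflections_def by blast
qed

lemma coord_det_reflection:
  assumes "g \<in> hyp_reflections S \<kappa>"
  shows "coord_det (hyp_indices S) g = - 1"
proof -
  interpret group G by (rule group_hyp_group)
  let ?d = "coord_det (hyp_indices S)"
  obtain w v where w: "w \<in> carrier G" and v: "v \<in> set (ordered_basis S)"
    and g: "g = w \<otimes>\<^bsub>G\<^esub> hyp_refl S \<kappa> v \<otimes>\<^bsub>G\<^esub> inv\<^bsub>G\<^esub> w"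
    using assms by (auto simp: hyp_reflections_def)
  have "?d w * ?d (inv\<^bsub>G\<^esub> w) = 1"
    using w by (simp flip: coord_det_hyp_group_mult add: coord_det_hyp_group_one)
  moreover have "?d g = ?d w * - 1 * ?d (inv\<^bsub>G\<^esub> w)"
    using w v simple_reflection_in_hyp_group [OF v]
    by (simp add: g coord_det_hyp_group_mult coord_det_simple_reflection)
  ultimately show ?thesis
    by simp
qed

text \<open>For a conjugate \<open>w s\<^sub>v w\<^sup>-\<^sup>1\<close>, the functional is \<open>x \<mapsto> (w\<^sup>-\<^sup>1 x, v)\<close>. It is
  linear because \<open>w\<^sup>-\<^sup>1\<close> is, and the reflection fixes its kernel because \<open>s\<^sub>v\<close> fixes \<open>v\<^sup>\<bottom>\<close>.\<close>

lemma reflection_fixes_hyperplane: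
  assumes "g \<in> hyp_reflections S \<kappa>"
  shows "\<exists>\<phi>. linear_functional_on U \<phi> \<and> (\<forall>x\<in>U. \<phi> x = 0 \<longrightarrow> g x = x)"
proof -
  interpret group G by (rule group_hyp_group)
  obtain w v where w: "w \<in> carrier G" and v: "v \<in> set (ordered_basis S)"
    and g: "g = w \<otimes>\<^bsub>G\<^esub> hyp_refl S \<kappa> v \<otimes>\<^bsub>G\<^esub> inv\<^bsub>G\<^esub> w"
    using assms by (auto simp: hyp_reflections_def)
  note s = simple_reflection_in_hyp_group [OF v]
  define \<phi> where "\<phi> x = hyp_form S \<kappa> ((inv\<^bsub>G\<^esub> w) x) v" for x
  have "linear_functional_on U \<phi>"
    unfolding \<phi>_def using w
    by (intro linear_functional_on_comp [OF linear_functional_on_hyp_form] linear_map_on_hyp_group)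
       simp
  moreover have "g x = x" if x: "x \<in> U" "\<phi> x = 0" for x
  proof -
    have y: "(inv\<^bsub>G\<^esub> w) x \<in> U"
      using w x hyp_group_mem by simp
    have "g x = w (hyp_refl S \<kappa> v ((inv\<^bsub>G\<^esub> w) x))"
      using w s x y by (simp add: g hyp_group_mult_apply hyp_group_mem)
    also have "\<dots> = w ((inv\<^bsub>G\<^esub> w) x)"
      using x y by (simp add: simple_reflection_fixes_orthogonal \<phi>_def)
    also have "\<dots> = (w \<otimes>\<^bsub>G\<^esub> inv\<^bsub>G\<^esub> w) x"
      by (rule hyp_group_mult_apply [symmetric]) (use w x in auto)
    also have "\<dots> = x"
      using w x by (simp add: hyp_group_one)
    finally show ?thesis .
  qed
  ultimately show ?thesis
    by blast
qed

lemma list_mult_Nil: "list_mult H [] = \<one>\<^bsub>H\<^esub>"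
  and list_mult_Cons: "list_mult H (x # xs) = x \<otimes>\<^bsub>H\<^esub> list_mult H xs"
  by (simp_all add: list_mult_def)

lemma list_mult_in_hyp_group: "set gs \<subseteq> carrier G \<Longrightarrow> list_mult G gs \<in> carrier G"
proof -
  interpret group G by (rule group_hyp_group)
  show "set gs \<subseteq> carrier G \<Longrightarrow> list_mult G gs \<in> carrier G"
    by (induction gs) (auto simp: list_mult_Nil list_mult_Cons)
qed

lemma coord_det_reflection_product:
  assumes "set gs \<subseteq> hyp_reflections S \<kappa>"
  shows "coord_det (hyp_indices S) (list_mult G gs) = (- 1) ^ length gs"
  using assms
proof (induction gs)
  case Nil
  show ?case by (simp add: list_mult_Nil coord_det_hyp_group_one)
next
  case (Cons g gs)
  then have "g \<in> carrier G" "list_mult G gs \<in> carrier G"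
    using reflection_in_hyp_group by (auto intro!: list_mult_in_hyp_group)
  with Cons show ?case
    by (simp add: list_mult_Cons coord_det_hyp_group_mult coord_det_reflection)
qed

lemma reflection_product_fixes_common_kernel:
  assumes "set gs \<subseteq> hyp_reflections S \<kappa>"
  shows "\<exists>\<phi>s. length \<phi>s = length gs \<and> (\<forall>\<phi>\<in>set \<phi>s. linear_functional_on U \<phi>)
    \<and> (\<forall>x\<in>U. (\<forall>\<phi>\<in>set \<phi>s. \<phi> x = 0) \<longrightarrow> list_mult G gs x = x)"
  using assms
proof (induction gs)
  case Nil
  show ?case by (simp add: list_mult_Nil hyp_group_one)
next
  case (Cons g gs)
  then obtain \<phi>s where \<phi>s: "length \<phi>s = length gs" "\<forall>\<phi>\<in>set \<phi>s. linear_functional_on U \<phi>"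
    "\<forall>x\<in>U. (\<forall>\<phi>\<in>set \<phi>s. \<phi> x = 0) \<longrightarrow> list_mult G gs x = x"
    by auto
  obtain \<phi> where \<phi>: "linear_functional_on U \<phi>" "\<forall>x\<in>U. \<phi> x = 0 \<longrightarrow> g x = x"
    using Cons.prems reflection_fixes_hyperplane [of g] by auto
  have "g \<in> carrier G" "list_mult G gs \<in> carrier G"
    using Cons.prems reflection_in_hyp_group by (auto intro!: list_mult_in_hyp_group)
  then show ?case
    using \<phi> \<phi>s by (intro exI [of _ "\<phi> # \<phi>s"]) (simp add: list_mult_Cons hyp_group_mult_apply)
qed

section \<open>Vectors fixed by the Coxeter element\<close>

text \<open>The reflections of a list of distinct basis vectors can be read off one coordinate at a time: the
  leftmost one, \<open>s\<^sub>u\<close>, is the only one that changes the coordinate at \<open>u\<close>, and it changes no other.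
  If the product \<open>s\<^sub>u Q\<close> fixes \<open>x\<close>, then \<open>Q x\<close> agrees with \<open>x\<close> away from \<open>u\<close> because of \<open>s\<^sub>u\<close>, and at \<open>u\<close>
  because of \<open>Q\<close>. Hence \<open>Q\<close> and \<open>s\<^sub>u\<close> both fix \<open>x\<close>. The statement on coordinates outside the list is
  what makes this induction work.\<close>

lemma fixed_by_simple_product_orthogonal:
  assumes "distinct us" "set us \<subseteq> set (index_list S)" "x \<in> U"
  defines "P \<equiv> list_mult G (map (\<lambda>u. hyp_refl S \<kappa> (basis_vec u)) us)"
  shows "(\<forall>u. u \<notin> set us \<longrightarrow> P x u = x u)
    \<and> (P x = x \<longrightarrow> (\<forall>u\<in>set us. hyp_form S \<kappa> x (basis_vec u) = 0))"
  using assms(1,2) unfolding P_def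
proof (induction us)
  case Nil
  show ?case using assms(3) by (simp add: list_mult_Nil hyp_group_one)
next
  case (Cons u us)
  let ?s = "hyp_refl S \<kappa> (basis_vec u)"
  define Q where "Q = list_mult G (map (\<lambda>u. hyp_refl S \<kappa> (basis_vec u)) us)"
  have simple: "basis_vec v \<in> set (ordered_basis S)" if "v \<in> set (u # us)" for v
    using that Cons.prems by (auto simp: ordered_basis_def)
  have s: "?s \<in> carrier G" and Q: "Q \<in> carrier G"
    unfolding Q_def using simple
    by (auto intro!: list_mult_in_hyp_group simple_reflection_in_hyp_group)
  have Qx: "Q x \<in> U"
    using Q assms(3) by (rule hyp_group_mem)
  have IH: "\<forall>v. v \<notin> set us \<longrightarrow> Q x v = x v"
    "Q x = x \<longrightarrow> (\<forall>v\<in>set us. hyp_form S \<kappa> x (basis_vec v) = 0)"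
    using Cons by (simp_all add: Q_def)
  have P: "list_mult G (map (\<lambda>u. hyp_refl S \<kappa> (basis_vec u)) (u # us)) x = ?s (Q x)"
    using s Q assms(3) by (simp add: list_mult_Cons hyp_group_mult_apply flip: Q_def)
  have s_other: "?s y v = y v" if "y \<in> U" "v \<noteq> u" for y v
    using that by (simp add: hyp_refl_def basis_vec_apply)
  have "hyp_form S \<kappa> x (basis_vec v) = 0" if fixed: "?s (Q x) = x" and v: "v \<in> set (u # us)" for v
  proof -
    have Qx_eq: "Q x = x"
    proof
      fix v show "Q x v = x v"
        using IH(1) Cons.prems(1) s_other [OF Qx, of v] fixed by (cases "v = u") auto
    qed
    have "?s x u = x u"
      using fixed Qx_eq by simp
    then have "hyp_form S \<kappa> x (basis_vec u) = 0"
      using assms(3) hyp_form_basis_nonisotropic [OF symbol \<kappa> simple [of u]]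
      by (simp add: hyp_refl_def basis_vec_apply)
    then show ?thesis
      using IH(2) Qx_eq v by auto
  qed
  moreover have "?s (Q x) v = x v" if "v \<notin> set (u # us)" for v
    using that s_other [OF Qx, of v] IH(1) by auto
  ultimately show ?case
    unfolding P by blast
qed

lemma fixed_by_coxeter_orthogonal:
  assumes "x \<in> U" "hyp_coxeter S \<kappa> x = x" "u \<in> set (index_list S)"
  shows "hyp_form S \<kappa> x (basis_vec u) = 0"
  using fixed_by_simple_product_orthogonal [of "index_list S" x] assms index_list_distinct_length
  by (simp add: hyp_coxeter_def ordered_basis_def comp_def)

lemma hyp_form_basis_vec_right:
  assumes "v \<in> set (index_list S)"
  shows "hyp_form S \<kappa> x (basis_vec v) =
    (\<Sum>u\<in>set (index_list S). x u * (gram S \<kappa> u v + gram S \<kappa> v u))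
    + (if v = Base_star then x Hyp else 0)"
proof -
  have "K_form S \<kappa> x (basis_vec v) = (\<Sum>u\<in>set (index_list S). x u * gram S \<kappa> u v)"
  proof -
    have "K_form S \<kappa> x (basis_vec v) = (\<Sum>u\<in>set (index_list S). \<Sum>w\<in>set (index_list S).
        if w = v then x u * gram S \<kappa> u w else 0)"
      unfolding K_form_def by (intro sum.cong refl) (simp add: basis_vec_apply)
    then show ?thesis
      using assms by simp
  qed
  moreover have "K_form S \<kappa> (basis_vec v) x = (\<Sum>u\<in>set (index_list S). x u * gram S \<kappa> v u)"
  proof -
    have "K_form S \<kappa> (basis_vec v) x = (\<Sum>w\<in>set (index_list S). \<Sum>u\<in>set (index_list S).
        if w = v then x u * gram S \<kappa> w u else 0)"
      unfolding K_form_def by (intro sum.cong refl) (simp add: basis_vec_apply)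
    also have "\<dots> = (\<Sum>w\<in>set (index_list S). if w = v then (\<Sum>u\<in>set (index_list S). x u * gram S \<kappa> w u) else 0)"
      by (intro sum.cong) auto
    finally show ?thesis
      using assms by simp
  qed
  ultimately show ?thesis
    using assms by (auto simp: hyp_form_def B_form_def basis_vec_apply sum.distrib distrib_left)
qed

text \<open>The radical of the form on the lattice meets the span of the arm roots trivially, and the
  vector \<open>a'\<close> is excluded by \<open>(a, a') = 1\<close>. On one arm, orthogonality to the root at \<open>j\<close> says
  that the coordinates \<open>x\<^sub>j\<close> satisfy \<open>2 x\<^sub>j = x\<^sub>j\<^sub>-\<^sub>1 + x\<^sub>j\<^sub>+\<^sub>1\<close> with \<open>x\<^sub>0 = x\<^sub>p = 0\<close>; so \<open>x\<^sub>j = j x\<^sub>1\<close>, and the right end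
  point gives \<open>x\<^sub>1 = 0\<close>.\<close>

lemma orthogonal_determined_by_base_coordinates:
  assumes x: "x \<in> U" and orth: "\<forall>u\<in>set (index_list S). hyp_form S \<kappa> x (basis_vec u) = 0"
    and base: "x Base = 0" "x Base_star = 0"
  shows "x = (\<lambda>_. 0)"
proof -
  let ?I = "set (index_list S)"
  have B: "Base \<in> ?I" "Base_star \<in> ?I"
    by (simp_all add: set_index_list)
  have x_out: "x u = 0" if "u \<notin> ?I" "u \<noteq> Hyp" for u
    using x that by (simp add: hyp_vspace_def)
  \<comment> \<open>\<open>x\<close> is supported on the arms and \<open>a'\<close>, and no arm root distinguishes \<open>\<alpha>\<^sub>0\<close> from \<open>\<alpha>\<^sub>0\<^sub>*\<close>; the two
     pairings of \<open>x\<close> therefore differ exactly by its coordinate at \<open>a'\<close>\<close>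
  have "(\<Sum>u\<in>?I. x u * (gram S \<kappa> u Base + gram S \<kappa> Base u))
      = (\<Sum>u\<in>?I. x u * (gram S \<kappa> u Base_star + gram S \<kappa> Base_star u))"
  proof (rule sum.cong [OF refl])
    fix u assume "u \<in> ?I"
    then show "x u * (gram S \<kappa> u Base + gram S \<kappa> Base u)
        = x u * (gram S \<kappa> u Base_star + gram S \<kappa> Base_star u)"
      using base by (cases u rule: index.exhaust) auto
  qed
  moreover have "hyp_form S \<kappa> x (basis_vec Base) = 0" "hyp_form S \<kappa> x (basis_vec Base_star) = 0"
    using orth B by auto
  ultimately have Hyp: "x Hyp = 0"
    by (simp add: hyp_form_basis_vec_right B)
  have arm: "x (Arm i j) = 0" if i: "1 \<le> i" "i \<le> sym_t S" for i j
  proof -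
    define k where "k = real \<kappa> * real (sym_f S i) / real (sym_e S i)"
    have p: "sym_p S i \<ge> 2"
      using symbol i by (simp add: is_symbol_def)
    have in_I: "Arm i j \<in> ?I \<longleftrightarrow> 1 \<le> j \<and> j < sym_p S i" for j
      using i by (force simp: set_index_list)
    have k: "k > 0"
    proof -
      let ?e = "basis_vec (Arm i 1)"
      have "hyp_form S \<kappa> ?e ?e
          = (\<Sum>u\<in>?I. ?e u * (gram S \<kappa> u (Arm i 1) + gram S \<kappa> (Arm i 1) u))"
        using in_I [of 1] p by (simp add: hyp_form_basis_vec_right)
      also have "\<dots> = (\<Sum>u\<in>?I. if u = Arm i 1 then 2 * k else 0)"
        by (intro sum.cong) (auto simp: basis_vec_apply k_def)
      also have "\<dots> = 2 * k"
        using in_I [of 1] p by simp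
      finally show ?thesis
        using hyp_form_basis_nonisotropic [OF symbol \<kappa>, of ?e] in_I [of 1] p
        by (simp add: ordered_basis_def)
    qed
    have rec: "2 * x (Arm i j) = x (Arm i (j - 1)) + x (Arm i (Suc j))"
      if j: "1 \<le> j" "j < sym_p S i" for j
    proof -
      have "0 = (\<Sum>u\<in>?I. x u * (gram S \<kappa> u (Arm i j) + gram S \<kappa> (Arm i j) u))"
        using orth in_I [of j] j by (auto simp: hyp_form_basis_vec_right)
      also have "\<dots> = (\<Sum>u\<in>?I. (if u = Arm i j then 2 * k * x u else 0)
          + (if u = Arm i (j - 1) then - k * x u else 0)
          + (if u = Arm i (Suc j) then - k * x u else 0))"
      proof (rule sum.cong [OF refl])
        fix u assume "u \<in> ?I"
        then show "x u * (gram S \<kappa> u (Arm i j) + gram S \<kappa> (Arm i j) u)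
            = (if u = Arm i j then 2 * k * x u else 0)
            + (if u = Arm i (j - 1) then - k * x u else 0)
            + (if u = Arm i (Suc j) then - k * x u else 0)"
          using base j by (cases u rule: index.exhaust) (auto simp: k_def)
      qed
      also have "\<dots> = 2 * k * x (Arm i j) - k * x (Arm i (j - 1)) - k * x (Arm i (Suc j))"
        using in_I [of j] j by (simp add: sum.distrib x_out)
      finally have "k * (2 * x (Arm i j)) = k * (x (Arm i (j - 1)) + x (Arm i (Suc j)))"
        by (simp add: algebra_simps)
      with k show ?thesis
        by simp
    qed
    \<comment> \<open>\<open>Arm i 0\<close> and \<open>Arm i p\<^sub>i\<close> are not indices of the lattice, so \<open>x\<close> vanishes there\<close>
    have ends: "x (Arm i 0) = 0" "x (Arm i (sym_p S i)) = 0"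
      using in_I by (auto intro: x_out)
    have affine: "j \<le> sym_p S i \<longrightarrow> x (Arm i j) = real j * x (Arm i 1)" for j
    proof (induction j rule: induct_nat_012)
      case (ge2 j)
      then show ?case
        using rec [of "Suc j"] by (auto simp: algebra_simps)
    qed (simp_all add: ends)
    have "x (Arm i 1) = 0"
      using affine [of "sym_p S i"] ends(2) p by simp
    then show ?thesis
      using affine [of j] x_out [of "Arm i j"] in_I [of j] by (cases "j \<le> sym_p S i") auto
  qed
  show ?thesis
  proof
    fix u show "x u = 0"
    proof (cases u)
      case (Arm i j)
      then show ?thesis
        using arm [of i j] x_out [of u]
        by (cases "1 \<le> i \<and> i \<le> sym_t S") (force simp: set_index_list)+
    qed (use base Hyp in auto)
  qed
qed

section \<open>The reflection length of the Coxeter element\<close>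

lemma coxeter_is_product_of_simple_reflections:
  "\<exists>gs. length gs = length (index_list S) \<and> set gs \<subseteq> hyp_reflections S \<kappa>
    \<and> list_mult G gs = hyp_coxeter S \<kappa>"
  using simple_reflection_is_reflection
  by (intro exI [of _ "map (hyp_refl S \<kappa>) (ordered_basis S)"])
     (auto simp: hyp_coxeter_def ordered_basis_def)

text \<open>With fewer than \<open>n\<close> reflections, parity leaves at most \<open>n - 2\<close>. Their functionals together
  with the coordinates at \<open>\<alpha>\<^sub>0\<close> and \<open>\<alpha>\<^sub>0\<^sub>*\<close> are at most \<open>n\<close> in a space of dimension \<open>n + 1\<close>, and a common
  zero of them contradicts \<open>orthogonal_determined_by_base_coordinates\<close>.\<close>

lemma coxeter_needs_rank_many_reflections:
  assumes gs: "set gs \<subseteq> hyp_reflections S \<kappa>" and prod: "list_mult G gs = hyp_coxeter S \<kappa>"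
  shows "length (index_list S) \<le> length gs"
proof (rule ccontr)
  assume "\<not> length (index_list S) \<le> length gs"
  moreover have "even (length gs) = even (length (index_list S))"
  proof -
    obtain hs where hs: "length hs = length (index_list S)" "set hs \<subseteq> hyp_reflections S \<kappa>"
      "list_mult G hs = hyp_coxeter S \<kappa>"
      using coxeter_is_product_of_simple_reflections by blast
    have "(- 1 :: real) ^ length gs = (- 1) ^ length (index_list S)"
      using coord_det_reflection_product [OF gs] coord_det_reflection_product [OF hs(2)] hs prod
      by simp
    then show ?thesis
      by (cases "even (length gs)"; cases "even (length (index_list S))") auto
  qed
  \<comment> \<open>\<open>length gs = n - 1\<close> is excluded by parity\<close>
  ultimately have few: "length gs + 2 < length (hyp_indices S)"
    by (cases "length (index_list S) = Suc (length gs)") auto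
  obtain \<phi>s where \<phi>s: "length \<phi>s = length gs" "\<forall>\<phi>\<in>set \<phi>s. linear_functional_on U \<phi>"
    and fixed: "\<forall>x\<in>U. (\<forall>\<phi>\<in>set \<phi>s. \<phi> x = 0) \<longrightarrow> list_mult G gs x = x"
    using reflection_product_fixes_common_kernel [OF gs] by blast
  let ?\<psi>s = "(\<lambda>x. x Base) # (\<lambda>x. x Base_star) # \<phi>s"
  obtain x where x: "x \<in> U" "x \<noteq> (\<lambda>_. 0)" "\<forall>\<phi>\<in>set ?\<psi>s. \<phi> x = 0"
    using common_zero_of_few_functionals [OF distinct_hyp_indices, of ?\<psi>s S] \<phi>s few
    by (auto simp: hyp_vspace_eq_coord_space linear_functional_on_coordinate)
  then have "hyp_coxeter S \<kappa> x = x"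
    using fixed prod by simp
  with x have "x = (\<lambda>_. 0)"
    using fixed_by_coxeter_orthogonal by (intro orthogonal_determined_by_base_coordinates) auto
  with x(2) show False ..
qed

end

theorem corollary5p18:
  fixes S :: symbol and \<kappa> n :: nat
  assumes "is_symbol S"
    and "admissible S \<kappa>"
    and "tubular S"
    and "n = free_rank (cb_lattice S)"
  shows "word_length (hyp_group S \<kappa>) (hyp_reflections S \<kappa>) (hyp_coxeter S \<kappa>) = n"
proof -
  have \<kappa>: "\<kappa> \<ge> 1"
    using assms(2) by (simp add: admissible_def)
  have n: "n = length (index_list S)"
    using assms(4) index_list_distinct_length by (simp add: free_rank_cb_lattice)
  show ?thesis
    unfolding word_length_def n
    using coxeter_is_product_of_simple_reflections [OF assms(1) \<kappa>]
      coxeter_needs_rank_many_reflections [OF assms(1) \<kappa>]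
    by (intro Least_equality) auto
qed

end
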